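(* There is no rationally independent Borel set in $\mathbb R$ of positive Fourier dimension.
   Context: A set $E\subseteq\mathbb R$ is rationally independent if for any integer $v\ge2$ and any choice of distinct points $x_1,\ldots,x_v\in E$, the relation $\sum_{j=1}^v a_jx_j=0$ with $a_1,\ldots,a_v\in\mathbb Z$ implies $a_1=\cdots=a_v=0$. The Fourier transform of a measure $\mu$ is $\widehat\mu(\xi)=\int e^{-ix\xi}\,d\mu(x)$. The Fourier dimension $\dim_{\mathbb F}(A)$ of a Borel set $A\subseteq\mathbb R$ is the supremum of exponents $\beta\le 1$ for which there exist a probability measure $\mu$ supported on $A$ and a finite constant $C_2>0$ with $|\widehat\mu(\xi)|\le C_2(1+|\xi|)^{-\beta/2}$ for all $\xi\in\mathbb R$. *)

theory Defs
  imports "HOL-Probability.Probability"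
begin

definition rationally_independent :: "real set \<Rightarrow> bool" where
  "rationally_independent E \<longleftrightarrow>
    (\<forall>v\<ge>2. \<forall>x :: nat \<Rightarrow> real. inj_on x {1..v} \<and> x ` {1..v} \<subseteq> E \<longrightarrow>
      (\<forall>a :: nat \<Rightarrow> int. (\<Sum>j=1..v. of_int (a j) * x j) = 0 \<longrightarrow> (\<forall>j\<in>{1..v}. a j = 0)))"

text \<open>The sign in the exponent is opposite to that of the library's \<^const>\<open>char\<close>.\<close>

definition fourier_transform :: "real measure \<Rightarrow> real \<Rightarrow> complex" where
  "fourier_transform \<mu> \<xi> = (CLINT x|\<mu>. exp (- (\<i> * complex_of_real x * complex_of_real \<xi>)))"

text \<open>
  A Borel probability measure is supported on a Borel set \<open>A\<close> if it gives \<open>A\<close> full mass; its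
  topological support need not be contained in \<open>A\<close>. The supremum is taken in the extended reals
  because the set of exponents is empty for empty \<open>A\<close>, and then the dimension is \<open>-\<infinity>\<close>. For nonempty
  Borel \<open>A\<close> every \<open>\<beta> \<le> 0\<close> is admissible (take a point mass), so the value lies between 0 and 1.
\<close>

definition fourier_dimension :: "real set \<Rightarrow> ereal" where
  "fourier_dimension A = Sup {ereal \<beta> | \<beta>. \<beta> \<le> 1 \<and>
    (\<exists>\<mu>. real_distribution \<mu> \<and> emeasure \<mu> A = 1 \<and>
      (\<exists>C>0. \<forall>\<xi>. cmod (fourier_transform \<mu> \<xi>) \<le> C * (1 + \<bar>\<xi>\<bar>) powr (- \<beta> / 2)))}"

end

theory Submission
  imports Defs
begin

text \<open>
  Suppose a probability measure \<open>M\<close> on \<open>E\<close> has polynomial Fourier decay. For large \<open>n\<close> its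
  \<open>n\<close>-fold convolution power has an integrable Fourier transform, so it gives mass \<open>O(h)\<close> to
  intervals of length \<open>h\<close> and vanishes on compact Lebesgue null sets. Take a compact \<open>K \<subseteq> E\<close>
  with \<open>M K > 0\<close> (but do not restrict \<open>M\<close> to \<open>K\<close>, which would destroy the decay). The \<open>n\<close>-fold
  sumset \<open>C\<close> of \<open>K\<close> has positive mass, hence positive Lebesgue measure, and by Steinhaus
  \<open>C - C\<close> contains an interval around 0. So it contains some \<open>s \<noteq> 0\<close> together with
  \<open>(n + 1) * s\<close>. By independence the integer coefficients of \<open>(n + 1) * s\<close> over \<open>K\<close> are
  \<open>n + 1\<close> times those of \<open>s\<close>, yet they are bounded by \<open>n\<close>, so they all vanish: a contradiction.
\<close>

section \<open>Iterated sumsets and rational independence\<close>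

primrec sumset_power :: "real set \<Rightarrow> nat \<Rightarrow> real set" where
  "sumset_power A 0 = {0}"
| "sumset_power A (Suc n) = {x + y | x y. x \<in> A \<and> y \<in> sumset_power A n}"

text \<open>The law of a sum of \<open>n\<close> independent variables of law \<open>M\<close>; the
  point mass at 0 is neutral for convolution.\<close>

primrec convolution_power :: "real measure \<Rightarrow> nat \<Rightarrow> real measure" where
  "convolution_power M 0 = return borel 0"
| "convolution_power M (Suc n) = convolution M (convolution_power M n)"

lemma compact_sumset_power: "compact A \<Longrightarrow> compact (sumset_power A n)"
  by (induction n) (auto intro: compact_sums)

text \<open>The coefficient of a point counts its uses as a summand, hence the bound
  \<open>n\<close>. Since \<open>c\<close> vanishes off \<open>F\<close>, the support may be
  enlarged, so several sums can be written over one finite set.\<close>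

lemma sumset_power_coefficients:
  assumes "x \<in> sumset_power A n"
  shows "\<exists>c F. finite F \<and> F \<subseteq> A \<and> (\<forall>y. 0 \<le> c y \<and> c y \<le> int n) \<and> (\<forall>y. y \<notin> F \<longrightarrow> c y = 0) \<and>
    x = (\<Sum>y\<in>F. of_int (c y) * y)"
  using assms
proof (induction n arbitrary: x)
  case 0
  then show ?case by (intro exI[of _ "\<lambda>_. 0"] exI[of _ "{}"]) auto
next
  case (Suc n)
  then obtain a z where a: "a \<in> A" and z: "z \<in> sumset_power A n" and x: "x = a + z"
    by auto
  from Suc.IH[OF z] obtain c F where F: "finite F" "F \<subseteq> A" "\<And>y. 0 \<le> c y \<and> c y \<le> int n"
    "\<And>y. y \<notin> F \<Longrightarrow> c y = 0" and zc: "z = (\<Sum>y\<in>F. of_int (c y) * y)"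
    by blast
  have "z = (\<Sum>y\<in>insert a F. of_int (c y) * y)"
    unfolding zc using F by (intro sum.mono_neutral_left) auto
  moreover have "(\<Sum>y\<in>insert a F. of_int (c y + of_bool (y = a)) * y) =
      (\<Sum>y\<in>insert a F. of_int (c y) * y) + (\<Sum>y\<in>insert a F. if y = a then y else 0)"
    unfolding sum.distrib[symmetric] by (intro sum.cong) (auto simp: algebra_simps)
  moreover have "(\<Sum>y\<in>insert a F. if y = a then y else 0) = a"
    using F(1) by (subst sum.delta) auto
  ultimately have "x = (\<Sum>y\<in>insert a F. of_int (c y + of_bool (y = a)) * y)"
    using x by simp
  moreover have "0 \<le> c y + of_bool (y = a) \<and> c y + of_bool (y = a) \<le> int (Suc n)" for y
    using F(3)[of y] by auto
  moreover have "\<forall>y. y \<notin> insert a F \<longrightarrow> c y + of_bool (y = a) = 0"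
    using F(4) by auto
  ultimately show ?case
    using F(1,2) a by (intro exI[of _ "\<lambda>y. c y + of_bool (y = a)"] exI[of _ "insert a F"]) blast
qed

text \<open>Stating the conclusion as \<open>a y * y = 0\<close> covers the sets with fewer than two points,
  about which rational independence says nothing.\<close>
lemma rationally_independent_sum_eq_0:
  assumes "rationally_independent E" "finite F" "F \<subseteq> E" "(\<Sum>y\<in>F. of_int (a y) * y) = 0" "y \<in> F"
  shows "of_int (a y) * y = 0"
proof (cases "card F \<ge> 2")
  case True
  obtain h where h: "bij_betw h {1..card F} F"
    using ex_bij_betw_nat_finite_1[OF assms(2)] by blast
  have "(\<Sum>j=1..card F. of_int (a (h j)) * h j) = 0"
    using sum.reindex_bij_betw[OF h, of "\<lambda>y. of_int (a y) * y"] assms(4) by simp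
  moreover have "inj_on h {1..card F}" "h ` {1..card F} \<subseteq> E"
    using h assms(3) by (auto simp: bij_betw_def)
  ultimately have "\<forall>j\<in>{1..card F}. a (h j) = 0"
    using assms(1) True unfolding rationally_independent_def by meson
  moreover obtain j where "j \<in> {1..card F}" "h j = y"
    using h assms(5) by (metis bij_betw_imp_surj_on imageE)
  ultimately show ?thesis by auto
next
  case False
  then have "card F = 1"
    using assms(2,5) card_gt_0_iff[of F] by auto
  then have "F = {y}"
    using assms(5) by (auto simp: card_1_singleton_iff)
  then show ?thesis using assms(4) by simp
qed

text \<open>Multiplication by \<open>n + 1\<close> pushes every nonzero difference of
  \<open>n\<close>-fold sums out of the range of bounded coefficients, so such differences cannot
  fill a neighbourhood of 0.\<close>

lemma rationally_independent_sumset_power_differences: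
  assumes E: "rationally_independent E" and "\<delta> > 0"
  shows "\<exists>t. \<bar>t\<bar> < \<delta> \<and> (\<forall>x\<in>sumset_power E n. \<forall>y\<in>sumset_power E n. t \<noteq> x - y)"
proof (rule ccontr)
  assume "\<not> ?thesis"
  then have D: "\<exists>x\<in>sumset_power E n. \<exists>y\<in>sumset_power E n. t = x - y" if "\<bar>t\<bar> < \<delta>" for t
    using that by blast
  \<comment> \<open>Chosen so that both \<open>s\<close> and \<open>(n + 1) * s\<close>, which
    equals \<open>\<delta> / 2\<close>, lie in the interval.\<close>
  define s where "s = \<delta> / (2 * (real n + 1))"
  have s: "s > 0" using assms(2) by (simp add: s_def)
  have "(real n + 1) * s = \<delta> / 2" by (simp add: s_def field_simps)
  then have ns: "\<bar>(real n + 1) * s\<bar> < \<delta>" using assms(2) by simp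
  have "1 * s \<le> (real n + 1) * s" using s by (intro mult_right_mono) auto
  then have "\<bar>s\<bar> < \<delta>" using s ns by linarith
  obtain x1 x2 x3 x4 where x: "x1 \<in> sumset_power E n" "x2 \<in> sumset_power E n"
    "x3 \<in> sumset_power E n" "x4 \<in> sumset_power E n"
    and t: "(real n + 1) * s = x1 - x2" and sx: "s = x3 - x4"
    using D[OF \<open>\<bar>s\<bar> < \<delta>\<close>] D[OF ns] by blast
  obtain c1 F1 where F1: "finite F1" "F1 \<subseteq> E" "\<And>y. 0 \<le> c1 y \<and> c1 y \<le> int n"
    "\<And>y. y \<notin> F1 \<Longrightarrow> c1 y = 0" and x1: "x1 = (\<Sum>y\<in>F1. of_int (c1 y) * y)"
    using sumset_power_coefficients[OF x(1)] by blast
  obtain c2 F2 where F2: "finite F2" "F2 \<subseteq> E" "\<And>y. 0 \<le> c2 y \<and> c2 y \<le> int n"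
    "\<And>y. y \<notin> F2 \<Longrightarrow> c2 y = 0" and x2: "x2 = (\<Sum>y\<in>F2. of_int (c2 y) * y)"
    using sumset_power_coefficients[OF x(2)] by blast
  obtain c3 F3 where F3: "finite F3" "F3 \<subseteq> E" "\<And>y. 0 \<le> c3 y \<and> c3 y \<le> int n"
    "\<And>y. y \<notin> F3 \<Longrightarrow> c3 y = 0" and x3: "x3 = (\<Sum>y\<in>F3. of_int (c3 y) * y)"
    using sumset_power_coefficients[OF x(3)] by blast
  obtain c4 F4 where F4: "finite F4" "F4 \<subseteq> E" "\<And>y. 0 \<le> c4 y \<and> c4 y \<le> int n"
    "\<And>y. y \<notin> F4 \<Longrightarrow> c4 y = 0" and x4: "x4 = (\<Sum>y\<in>F4. of_int (c4 y) * y)"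
    using sumset_power_coefficients[OF x(4)] by blast
  define G where "G = F1 \<union> F2 \<union> F3 \<union> F4"
  have G: "finite G" "G \<subseteq> E" using F1 F2 F3 F4 by (auto simp: G_def)
  have xG: "x1 = (\<Sum>y\<in>G. of_int (c1 y) * y)" "x2 = (\<Sum>y\<in>G. of_int (c2 y) * y)"
    "x3 = (\<Sum>y\<in>G. of_int (c3 y) * y)" "x4 = (\<Sum>y\<in>G. of_int (c4 y) * y)"
    unfolding x1 x2 x3 x4 using G(1) F1(4) F2(4) F3(4) F4(4)
    by (auto intro!: sum.mono_neutral_left simp: G_def)
  \<comment> \<open>The coefficients of the relation
    \<open>(x1 - x2) - (n + 1) * (x3 - x4) = 0\<close> over \<open>G\<close>.\<close>
  define a where "a y = (c1 y - c2 y) - (int n + 1) * (c3 y - c4 y)" for y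
  have "(\<Sum>y\<in>G. of_int (a y) * y) = (x1 - x2) - (real n + 1) * (x3 - x4)"
    unfolding xG by (simp add: a_def algebra_simps sum.distrib sum_subtractf sum_distrib_left)
  also have "\<dots> = 0" using t sx by simp
  finally have a0: "of_int (a y) * y = 0" if "y \<in> G" for y
    using rationally_independent_sum_eq_0[OF E G _ that] by blast
  have "of_int (c3 y) * y - of_int (c4 y) * y = 0" if "y \<in> G" for y
  \<comment> \<open>At the point 0 nothing is known about the coefficient, but the term vanishes
    anyway.\<close>
  proof (cases "y = 0")
    case False
    then have "c1 y - c2 y = (int n + 1) * (c3 y - c4 y)"
      using a0[OF that] unfolding a_def mult_eq_0_iff of_int_eq_0_iff by auto
    \<comment> \<open>Both coefficients lie between 0 and \<open>n\<close>; a multiple of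
      \<open>n + 1\<close> this small must be 0.\<close>
    moreover have "\<bar>c1 y - c2 y\<bar> < int n + 1"
      using F1(3)[of y] F2(3)[of y] by linarith
    ultimately have "c3 y - c4 y = 0"
      using dvd_imp_le_int[of "c1 y - c2 y" "int n + 1"] by (cases "c1 y - c2 y = 0") auto
    then show ?thesis by simp
  qed simp
  then have "s = 0"
    unfolding sx xG sum_subtractf[symmetric] by (rule sum.neutral[OF ballI])
  with s show False by simp
qed

section \<open>Steinhaus theorem for compact sets\<close>

text \<open>Enclose \<open>C\<close> in an open \<open>U\<close> with \<open>U - C\<close> of
  smaller measure than \<open>C\<close>. A small translate of \<open>C\<close> stays in
  \<open>U\<close>, and is too large to fit into \<open>U - C\<close>, so it meets
  \<open>C\<close>.\<close>

lemma Steinhaus_compact: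
  fixes C :: "real set"
  assumes C: "compact C" and pos: "emeasure lborel C > 0"
  obtains \<delta> where "\<delta> > 0" "\<And>t. \<bar>t\<bar> < \<delta> \<Longrightarrow> \<exists>x\<in>C. \<exists>y\<in>C. t = x - y"
proof -
  have Cb: "C \<in> sets borel" using C by (simp add: borel_compact)
  have fin: "emeasure lborel C < \<infinity>"
    by (rule emeasure_bounded_finite[OF compact_imp_bounded[OF C]])
  define e where "e = measure lborel C"
  have e: "emeasure lborel C = ennreal e" "e > 0"
    using fin pos by (simp_all add: e_def emeasure_eq_ennreal_measure[of lborel C] less_top[symmetric])
  obtain U where U: "open U" "C \<subseteq> U" "emeasure lborel (U - C) < ennreal e"
    using outer_regular_lborel[OF Cb e(2)] by blast
  obtain \<delta> where \<delta>: "\<delta> > 0" "(\<Union>x\<in>C. ball x \<delta>) \<subseteq> U"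
    using compact_subset_open_imp_ball_epsilon_subset[OF C U(1,2)] by blast
  have "\<exists>x\<in>C. \<exists>y\<in>C. t = x - y" if t: "\<bar>t\<bar> < \<delta>" for t
  proof (rule ccontr)
    assume neg: "\<not> ?thesis"
    define D where "D = (\<lambda>x. t + x) ` C"
    have D: "compact D" unfolding D_def by (rule compact_translation[OF C])
    then have Db: "D \<in> sets borel" by (simp add: borel_compact)
    have "D \<inter> C = {}" using neg by (force simp: D_def)
    moreover have "D \<subseteq> U" using \<delta>(2) t by (force simp: D_def dist_real_def)
    ultimately have "emeasure lborel D \<le> emeasure lborel (U - C)"
      using U(1) Cb by (intro emeasure_mono) auto
    moreover have "emeasure lborel D = emeasure lborel C"
    proof -
      have "emeasure lborel D = emeasure (distr lborel borel ((+) t)) D"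
        by (simp add: lborel_distr_plus)
      also have "\<dots> = emeasure lborel C"
        using Db by (subst emeasure_distr) (auto simp: D_def intro!: arg_cong[where f="emeasure lborel"])
      finally show ?thesis .
    qed
    ultimately show False using U(3) e by simp
  qed
  with \<delta>(1) that show thesis by blast
qed

section \<open>Convolution powers and their characteristic functions\<close>

lemma real_distribution_convolution_power:
  assumes "real_distribution M"
  shows "real_distribution (convolution_power M n)"
proof (induction n)
  case 0
  show ?case
    by (auto simp: real_distribution_def real_distribution_axioms_def prob_space_return)
next
  case (Suc n)
  interpret M: real_distribution M by fact
  interpret N: real_distribution "convolution_power M n" by (rule Suc.IH)
  interpret P: pair_prob_space M "convolution_power M n" ..
  show ?case
    unfolding convolution_power.simps convolution_def
    by (rule P.real_distribution_distr) simp
qed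

lemma char_convolution:
  assumes "real_distribution M" "real_distribution N"
  shows "char (convolution M N) t = char M t * char N t"
proof -
  interpret M: real_distribution M by fact
  interpret N: real_distribution N by fact
  interpret P: pair_prob_space M N ..
  have int: "integrable (M \<Otimes>\<^sub>M N) (\<lambda>(x, y). iexp (t * (x + y)))"
    by (rule P.integrable_const_bound[where B=1]) (auto simp: case_prod_unfold)
  have "char (convolution M N) t = (CLINT z|M \<Otimes>\<^sub>M N. iexp (t * (fst z + snd z)))"
    unfolding char_def convolution_def by (subst integral_distr) (auto simp: case_prod_unfold)
  also have "\<dots> = (CLINT x|M. CLINT y|N. iexp (t * (x + y)))"
    using P.integral_fst'[OF int] by (simp add: case_prod_unfold)
  also have "\<dots> = (CLINT x|M. CLINT y|N. iexp (t * x) * iexp (t * y))"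
    by (simp add: distrib_left exp_add)
  also have "\<dots> = char M t * char N t"
    unfolding char_def by simp
  finally show ?thesis .
qed

lemma char_convolution_power:
  assumes "real_distribution M"
  shows "char (convolution_power M n) t = char M t ^ n"
proof (induction n)
  case 0
  then show ?case by (simp add: char_def integral_return)
next
  case (Suc n)
  then show ?case
    by (simp add: char_convolution assms real_distribution_convolution_power)
qed

text \<open>Addition maps \<open>A \<times> sumset_power A n\<close> into the next sumset, so the
  mass is bounded below by a product of positive masses. Compactness makes the sumsets
  measurable.\<close>

lemma emeasure_convolution_power_sumset_power:
  assumes M: "real_distribution M" and A: "compact A" "emeasure M A > 0"
  shows "emeasure (convolution_power M n) (sumset_power A n) > 0"
proof (induction n)
  case (Suc n)
  interpret M: real_distribution M by fact
  interpret N: real_distribution "convolution_power M n"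
    by (rule real_distribution_convolution_power[OF M])
  interpret P: pair_prob_space M "convolution_power M n" ..
  let ?B = "sumset_power A n"
  have sets: "A \<in> sets borel" "?B \<in> sets borel" "sumset_power A (Suc n) \<in> sets borel"
    using compact_sumset_power[OF A(1)] A(1) by (auto intro!: borel_compact simp del: sumset_power.simps)
  have "0 < emeasure M A * emeasure (convolution_power M n) ?B"
    using A(2) Suc.IH by (simp add: ennreal_zero_less_mult_iff)
  also have "\<dots> = emeasure (M \<Otimes>\<^sub>M convolution_power M n) (A \<times> ?B)"
    using sets by (simp add: N.emeasure_pair_measure_Times)
  also have "\<dots> \<le> emeasure (M \<Otimes>\<^sub>M convolution_power M n)
      ((\<lambda>(x, y). x + y) -` sumset_power A (Suc n) \<inter> space (M \<Otimes>\<^sub>M convolution_power M n))"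
  proof (rule emeasure_mono)
    show "A \<times> ?B \<subseteq> (\<lambda>(x, y). x + y) -` sumset_power A (Suc n) \<inter>
        space (M \<Otimes>\<^sub>M convolution_power M n)"
      by (auto simp: space_pair_measure)
    have "(\<lambda>(x, y). x + y) \<in> measurable (M \<Otimes>\<^sub>M convolution_power M n) borel" by simp
    then show "(\<lambda>(x, y). x + y) -` sumset_power A (Suc n) \<inter> space (M \<Otimes>\<^sub>M convolution_power M n)
        \<in> sets (M \<Otimes>\<^sub>M convolution_power M n)"
      using sets(3) by (rule measurable_sets)
  qed
  also have "\<dots> = emeasure (convolution_power M (Suc n)) (sumset_power A (Suc n))"
    unfolding convolution_power.simps convolution_def using sets by (subst emeasure_distr) auto
  finally show ?case .
qed simp

section \<open>From integrable characteristic functions to null sets\<close>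

text \<open>The indicator of the interval is dominated by a multiple of a Gaussian, which is itself the
  characteristic function of a Gaussian; Fubini then brings in \<^term>\<open>char M\<close>.\<close>
lemma measure_interval_le_integral_char:
  assumes "real_distribution M" and int: "integrable lborel (\<lambda>t. cmod (char M t))" and h: "h > 0"
  shows "measure M {x - h..x + h} \<le> exp (1/2) * h * (LBINT t. cmod (char M t))"
proof -
  interpret M: real_distribution M by fact
  interpret N: real_distribution std_normal_distribution by (rule real_dist_normal_dist)
  interpret P: pair_prob_space std_normal_distribution M ..
  let ?f = "\<lambda>z y. iexp ((y - x) / h * z)"
  have gauss: "complex_of_real (exp (- ((y - x) / h)\<^sup>2 / 2)) = (CLINT z|std_normal_distribution. ?f z y)" for y
    using fun_cong[OF char_std_normal_distribution, of "(y - x) / h"] by (simp add: char_def)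
  \<comment> \<open>The factor \<open>exp (-1/2)\<close> is the least value on the interval of the
    Gaussian centred at \<open>x\<close> with scale \<open>h\<close>.\<close>
  have "exp (-1/2) * measure M {x - h..x + h} = (LINT y|M. exp (-1/2) * indicator {x - h..x + h} y)"
    by simp
  also have "\<dots> \<le> (LINT y|M. exp (- ((y - x) / h)\<^sup>2 / 2))"
  proof (rule integral_mono)
    show "integrable M (\<lambda>y. exp (- ((y - x) / h)\<^sup>2 / 2))"
      by (rule M.integrable_const_bound[where B=1]) auto
    show "exp (-1/2) * indicator {x - h..x + h} y \<le> exp (- ((y - x) / h)\<^sup>2 / 2)" for y
    proof (cases "y \<in> {x - h..x + h}")
      case True
      then have "\<bar>(y - x) / h\<bar> \<le> 1" using h by (simp add: abs_le_iff field_simps)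
      then have "((y - x) / h)\<^sup>2 \<le> 1" by (simp add: abs_square_le_1)
      then show ?thesis using True by simp
    qed simp
    show "integrable M (\<lambda>y. exp (-1/2) * indicator {x - h..x + h} y :: real)"
      by (rule M.integrable_const_bound[where B=1]) (auto simp: indicator_def)
  qed
  also have "\<dots> = cmod (CLINT y|M. complex_of_real (exp (- ((y - x) / h)\<^sup>2 / 2)))"
    by (subst integral_complex_of_real) simp
  also have "(CLINT y|M. complex_of_real (exp (- ((y - x) / h)\<^sup>2 / 2))) =
      (CLINT y|M. CLINT z|std_normal_distribution. ?f z y)"
    by (simp only: gauss)
  also have "\<dots> = (CLINT z|std_normal_distribution. CLINT y|M. ?f z y)"
    by (rule P.Fubini_integral, rule P.integrable_const_bound[where B=1]) (auto simp: case_prod_unfold)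
  \<comment> \<open>Centring at \<open>x\<close> only contributes a factor of modulus 1, so the
    final bound is uniform in \<open>x\<close>.\<close>
  also have "\<dots> = (CLINT z|std_normal_distribution. iexp (- x / h * z) * char M (z / h))"
  proof (rule Bochner_Integration.integral_cong[OF refl])
    fix z
    have "?f z y = iexp (- x / h * z) * iexp (z / h * y)" for y
      by (simp add: exp_add[symmetric] diff_divide_distrib algebra_simps)
    then show "(CLINT y|M. ?f z y) = iexp (- x / h * z) * char M (z / h)"
      unfolding char_def by (simp only: integral_mult_right_zero)
  qed
  also have "cmod \<dots> \<le> (LINT z|std_normal_distribution. cmod (iexp (- x / h * z) * char M (z / h)))"
    by (rule integral_norm_bound)
  also have "\<dots> = (LINT z|std_normal_distribution. cmod (char M (z / h)))"
    by (simp add: norm_mult)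
  also have "\<dots> = (LBINT z. std_normal_density z * cmod (char M (z / h)))"
    by (subst integral_real_density) auto
  also have "\<dots> \<le> (LBINT z. cmod (char M (z / h)))"
  proof (rule integral_mono')
    show "integrable lborel (\<lambda>z. cmod (char M (z / h)))"
      using lborel_integrable_real_affine[OF int, of "1 / h" 0] h by simp
    have "std_normal_density z \<le> 1" for z
    proof -
      have "1 \<le> sqrt (2 * pi)" using pi_gt3 by (intro real_le_rsqrt) simp
      then have "1 / sqrt (2 * pi) * exp (- z\<^sup>2 / 2) \<le> 1 * 1"
        by (intro mult_mono) auto
      then show ?thesis by (simp add: std_normal_density_def)
    qed
    then show "std_normal_density z * cmod (char M (z / h)) \<le> cmod (char M (z / h))" for z
      by (intro mult_left_le_one_le) auto
  qed auto
  \<comment> \<open>The substitution \<open>t = z / h\<close> produces the factor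
    \<open>h\<close>.\<close>
  also have "\<dots> = h * (LBINT t. cmod (char M t))"
    using lborel_integral_real_affine[of "1 / h" "\<lambda>t. cmod (char M t)" 0] h by simp
  finally have "exp (1/2) * (exp (-1/2) * measure M {x - h..x + h}) \<le>
      exp (1/2) * (h * (LBINT t. cmod (char M t)))"
    by (intro mult_left_mono) auto
  then show ?thesis by (simp add: exp_minus mult.assoc[symmetric])
qed

text \<open>Integrate \<open>measure M (C \<inter> {x - h..x + h})\<close> over \<open>x\<close> in two ways.\<close>
lemma emeasure_compact_eq_0:
  assumes "real_distribution M"
    and K: "\<And>x h. h > 0 \<Longrightarrow> measure M {x - h..x + h} \<le> K * h"
    and C: "compact C" "emeasure lborel C = 0"
  shows "emeasure M C = 0"
proof -
  interpret M: real_distribution M by fact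
  interpret P: pair_sigma_finite lborel M ..
  have Cb: "C \<in> sets borel" using C by (simp add: borel_compact)
  have K0: "K \<ge> 0" using K[of 1 0] measure_nonneg[of M "{0 - 1..0 + 1}"] by linarith
  have bound: "2 * emeasure M C \<le> ennreal (K * e)" if e: "e > 0" for e
  proof -
    obtain U where U: "open U" "C \<subseteq> U" "emeasure lborel (U - C) < ennreal e"
      using outer_regular_lborel[OF Cb e] by blast
    have "emeasure lborel U = emeasure lborel C + emeasure lborel (U - C)"
      using U Cb by (subst plus_emeasure) (auto intro!: arg_cong[where f="emeasure lborel"])
    then have Ue: "emeasure lborel U \<le> ennreal e" using U(3) C(2) by simp
    obtain \<delta> where \<delta>: "\<delta> > 0" "(\<Union>x\<in>C. ball x \<delta>) \<subseteq> U"
      using compact_subset_open_imp_ball_epsilon_subset[OF C(1) U(1,2)] by blast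
    \<comment> \<open>Half the radius, so that closed intervals of radius \<open>h\<close> around
      points of \<open>C\<close> stay in \<open>U\<close>; hence \<open>?g x y\<close> vanishes for
      \<open>x\<close> outside \<open>U\<close>.\<close>
    define h where "h = \<delta> / 2"
    have h: "h > 0" using \<delta> by (simp add: h_def)
    let ?g = "\<lambda>x y. indicator C y * indicator {y - h..y + h} x :: ennreal"
    have g: "(\<lambda>(x, y). ?g x y) \<in> borel_measurable (lborel \<Otimes>\<^sub>M M)"
    proof -
      have eq: "(\<lambda>(x, y). ?g x y) = (\<lambda>z. indicator C (snd z) * indicator {z. snd z - h \<le> fst z \<and> fst z \<le> snd z + h} z)"
        by (auto simp: fun_eq_iff indicator_def)
      show ?thesis unfolding eq using Cb by measurable
    qed
    \<comment> \<open>For fixed \<open>y\<close> in \<open>C\<close> the inner integral is the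
      length \<open>2 * h\<close> of the interval.\<close>
    have "ennreal (2 * h) * emeasure M C = (\<integral>\<^sup>+y. \<integral>\<^sup>+x. ?g x y \<partial>lborel \<partial>M)"
      using h Cb by (simp add: nn_integral_cmult mult.commute nn_integral_multc)
    also have "\<dots> = (\<integral>\<^sup>+x. \<integral>\<^sup>+y. ?g x y \<partial>M \<partial>lborel)"
      by (rule P.Fubini'[OF g])
    also have "\<dots> \<le> (\<integral>\<^sup>+x. ennreal (K * h) * indicator U x \<partial>lborel)"
    proof (rule nn_integral_mono)
      fix x :: real
      show "(\<integral>\<^sup>+y. ?g x y \<partial>M) \<le> ennreal (K * h) * indicator U x"
      proof (cases "x \<in> U")
        case True
        have "(\<integral>\<^sup>+y. ?g x y \<partial>M) \<le> (\<integral>\<^sup>+y. indicator {x - h..x + h} y \<partial>M)"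
          by (intro nn_integral_mono) (auto simp: indicator_def)
        also have "\<dots> = ennreal (measure M {x - h..x + h})"
          by (simp add: M.emeasure_eq_measure)
        also have "\<dots> \<le> ennreal (K * h)" using K[OF h] by (intro ennreal_leI)
        finally show ?thesis using True by simp
      next
        case False
        have "?g x y = 0" for y
        proof (rule ccontr)
          assume "?g x y \<noteq> 0"
          then have "y \<in> C" "x \<in> ball y \<delta>"
            using \<delta>(1) by (auto simp: indicator_def h_def dist_real_def abs_less_iff split: if_splits)
          then show False using False \<delta>(2) by blast
        qed
        then show ?thesis by (simp only: nn_integral_0_iff_AE) simp
      qed
    qed
    also have "\<dots> = ennreal (K * h) * emeasure lborel U"
      using U(1) by (simp add: nn_integral_cmult)
    also have "\<dots> \<le> ennreal (K * h) * ennreal e"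
      by (intro mult_left_mono Ue) simp
    also have "\<dots> = ennreal h * ennreal (K * e)"
      using h K0 e by (simp add: ennreal_mult[symmetric] algebra_simps)
    finally have "ennreal (2 * h * measure M C) \<le> ennreal (h * (K * e))"
      using h K0 e by (simp add: M.emeasure_eq_measure ennreal_mult)
    then have "2 * h * measure M C \<le> h * (K * e)"
      using h K0 e by (subst (asm) ennreal_le_iff) auto
    then have "2 * measure M C \<le> K * e" using h by simp
    then show ?thesis
      by (metis M.emeasure_eq_measure ennreal_leI ennreal_mult' ennreal_numeral zero_le_numeral)
  qed
  have "2 * measure M C \<le> 0 + e" if "e > 0" for e :: real
  proof -
    \<comment> \<open>Dividing by \<open>K + 1\<close> rather than \<open>K\<close> covers the case
      \<open>K = 0\<close>.\<close>
    have "2 * emeasure M C \<le> ennreal (K * (e / (K + 1)))" using that K0 by (intro bound) auto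
    also have "\<dots> \<le> ennreal e" using that K0 by (intro ennreal_leI) (simp add: field_simps)
    finally have "ennreal (2 * measure M C) \<le> ennreal e"
      by (simp add: M.emeasure_eq_measure ennreal_mult)
    then show ?thesis using that by simp
  qed
  then have "2 * measure M C \<le> 0" by (rule field_le_epsilon)
  then have "measure M C = 0" by (simp add: measure_le_0_iff)
  then show ?thesis by (simp add: M.emeasure_eq_measure)
qed

section \<open>Fourier decay contradicts independence\<close>

lemma cmod_char_eq_fourier_transform:
  "cmod (char M t) = cmod (fourier_transform M (- t))"
  by (simp add: char_def fourier_transform_def mult_ac)

lemma rationally_independent_no_Fourier_decay:
  assumes E: "E \<in> sets borel" "rationally_independent E"
    and M: "real_distribution M" "emeasure M E = 1"
    and \<beta>: "\<beta> > 0" and C: "C > 0"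
    and decay: "\<And>\<xi>. cmod (fourier_transform M \<xi>) \<le> C * (1 + \<bar>\<xi>\<bar>) powr (- \<beta> / 2)"
  shows False
proof -
  interpret M: real_distribution M by fact
  \<comment> \<open>This makes \<open>n * \<beta> / 2 > 2\<close>, so the \<open>n\<close>-th power
    of the decay bound is at most a multiple of the integrable function
    \<open>inverse (1 + t\<^sup>2)\<close>.\<close>
  obtain n :: nat where n: "real n > 4 / \<beta>" using reals_Archimedean2 by blast
  let ?N = "convolution_power M n"
  have N: "real_distribution ?N" by (rule real_distribution_convolution_power[OF M(1)])
  interpret N: real_distribution ?N by (rule N)
  have "0 < (SUP K \<in> {K. K \<subseteq> E \<and> compact K}. emeasure M K)"
    using inner_regular[of M E] E(1) M(2) by simp
  then obtain K where K: "K \<subseteq> E" "compact K" "emeasure M K > 0"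
    by (auto simp: less_SUP_iff)
  have bound: "cmod (char ?N t) \<le> C ^ n * inverse (1 + t\<^sup>2)" for t
  proof -
    have "cmod (char ?N t) = cmod (char M t) ^ n"
      by (simp add: char_convolution_power[OF M(1)] norm_power)
    also have "\<dots> \<le> (C * (1 + \<bar>t\<bar>) powr (- \<beta> / 2)) ^ n"
      using decay[of "- t"] by (intro power_mono) (auto simp: cmod_char_eq_fourier_transform)
    also have "\<dots> = C ^ n * (1 + \<bar>t\<bar>) powr (real n * (- \<beta> / 2))"
      by (simp add: power_mult_distrib powr_power mult.commute)
    also have "\<dots> \<le> C ^ n * (1 + \<bar>t\<bar>) powr (- 2)"
      using n \<beta> C by (intro mult_left_mono powr_mono) (auto simp: field_simps)
    also have "(1 + \<bar>t\<bar>) powr (- 2) = inverse ((1 + \<bar>t\<bar>)\<^sup>2)"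
      by (simp add: powr_minus powr_numeral)
    also have "\<dots> \<le> inverse (1 + t\<^sup>2)"
      by (intro le_imp_inverse_le) (auto simp: power2_eq_square algebra_simps add_pos_nonneg)
    finally show ?thesis using C by (simp add: mult_left_mono)
  qed
  have "integrable lborel (\<lambda>t::real. C ^ n * inverse (1 + t\<^sup>2))"
    using integrable_inverse_1_plus_square by (auto simp: set_integrable_def einterval_def)
  then have "integrable lborel (\<lambda>t. cmod (char ?N t))"
    by (rule Bochner_Integration.integrable_bound) (auto intro!: AE_I2 order_trans[OF bound])
  note interval = measure_interval_le_integral_char[OF N this]
  have "emeasure ?N (sumset_power K n) > 0"
    by (rule emeasure_convolution_power_sumset_power[OF M(1) K(2,3)])
  \<comment> \<open>Contrapositive: a Lebesgue null compact set would carry no mass of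
    \<open>?N\<close>.\<close>
  then have "emeasure lborel (sumset_power K n) > 0"
    using emeasure_compact_eq_0[OF N, of "exp (1/2) * (LBINT t. cmod (char ?N t))" "sumset_power K n"]
      interval compact_sumset_power[OF K(2)] by (force simp: mult_ac zero_less_iff_neq_zero)
  then obtain \<delta> where \<delta>: "\<delta> > 0"
    "\<And>t. \<bar>t\<bar> < \<delta> \<Longrightarrow> \<exists>x\<in>sumset_power K n. \<exists>y\<in>sumset_power K n. t = x - y"
    using Steinhaus_compact[OF compact_sumset_power[OF K(2)]] by blast
  have "rationally_independent K"
    using E(2) K(1) unfolding rationally_independent_def by (meson order_trans)
  then show False
    using rationally_independent_sumset_power_differences[OF _ \<delta>(1), of K n] \<delta>(2) by metis
qed

theorem corollary1p4:
  shows "\<not> (\<exists>E :: real set. E \<in> sets borel \<and> rationally_independent E \<and> fourier_dimension E > 0)"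
proof
  assume "\<exists>E :: real set. E \<in> sets borel \<and> rationally_independent E \<and> fourier_dimension E > 0"
  then obtain E where E: "E \<in> sets borel" "rationally_independent E" "fourier_dimension E > 0"
    by blast
  \<comment> \<open>A positive supremum exceeds 0 at some admissible exponent; the supremum need not
    be attained.\<close>
  from E(3) obtain \<beta> M C where "\<beta> > 0" "real_distribution M" "emeasure M E = 1" "C > 0"
    "\<And>\<xi>. cmod (fourier_transform M \<xi>) \<le> C * (1 + \<bar>\<xi>\<bar>) powr (- \<beta> / 2)"
    unfolding fourier_dimension_def less_Sup_iff by auto
  then show False
    using rationally_independent_no_Fourier_decay[OF E(1,2)] by blast
qed

end
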